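(* Let $r$ and $t$ be positive integers with $t\le r/2$ and $t$ odd. If $r$ is even or $r\ge (t+2)(t+1)$, then there exists an $r$-regular graph that is not $(r-t,t)$-colorable.
   Context: All graphs are finite, undirected pseudographs (multiple edges and loops allowed; a loop contributes $2$ to the degree). An $(r-t,t)$-coloring of an $r$-regular graph is an edge-coloring using at least two colors such that every vertex is incident to exactly $r-t$ edges of one color and exactly $t$ edges of a different color. *)

theory Defs
  imports Complex_Main "HOL-Library.Multiset"
begin

text \<open>
  Edges carry their own identity, so parallel edges are allowed; the ends of an edge form
  a multiset of size 2, a loop at \<open>v\<close> being an edge with ends \<open>{#v, v#}\<close>.
\<close>

record ('v, 'e) pseudograph =
  verts :: "'v set"
  edges :: "'e set"
  ends :: "'e \<Rightarrow> 'v multiset"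

text \<open>
  The vertex set is required to be nonempty: the null graph is vacuously regular of every
  degree and has no coloring with at least two colors.
\<close>

definition finite_pseudograph :: "('v, 'e) pseudograph \<Rightarrow> bool" where
  "finite_pseudograph G \<longleftrightarrow>
     finite (verts G) \<and> verts G \<noteq> {} \<and> finite (edges G) \<and>
     (\<forall>e\<in>edges G. size (ends G e) = 2 \<and> set_mset (ends G e) \<subseteq> verts G)"

definition degree :: "('v, 'e) pseudograph \<Rightarrow> 'v \<Rightarrow> nat" where
  "degree G v = (\<Sum>e\<in>edges G. count (ends G e) v)"

definition regular :: "nat \<Rightarrow> ('v, 'e) pseudograph \<Rightarrow> bool" where
  "regular r G \<longleftrightarrow> (\<forall>v\<in>verts G. degree G v = r)"

text \<open>As in the degree, a loop counts twice among the edges of its color at its vertex.\<close>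

definition color_degree :: "('v, 'e) pseudograph \<Rightarrow> ('e \<Rightarrow> 'c) \<Rightarrow> 'c \<Rightarrow> 'v \<Rightarrow> nat" where
  "color_degree G c a v = (\<Sum>e\<in>{e\<in>edges G. c e = a}. count (ends G e) v)"

text \<open>
  The total number of colors is not bounded, and the two colors seen at a vertex may
  depend on the vertex.
\<close>

definition split_coloring :: "('v, 'e) pseudograph \<Rightarrow> nat \<Rightarrow> nat \<Rightarrow> ('e \<Rightarrow> 'c) \<Rightarrow> bool" where
  "split_coloring G p q c \<longleftrightarrow>
     card (c ` edges G) \<ge> 2 \<and>
     (\<forall>v\<in>verts G. \<exists>a b. a \<noteq> b \<and> color_degree G c a v = p \<and> color_degree G c b v = q)"

text \<open>Colors are natural numbers; this loses no generality, since a finite graph uses only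
  finitely many colors.\<close>

definition split_colorable :: "('v, 'e) pseudograph \<Rightarrow> nat \<Rightarrow> nat \<Rightarrow> bool" where
  "split_colorable G p q \<longleftrightarrow> (\<exists>c :: 'e \<Rightarrow> nat. split_coloring G p q c)"

end

theory Submission
  imports Defs "HOL-Library.Nat_Bijection"
begin

text \<open>
  For even \<open>r\<close>, a single vertex with \<open>r / 2\<close> loops has only even color degrees, so no color
  has the odd degree \<open>t\<close>. For odd \<open>r\<close>, join a center \<open>x\<close> to each of \<open>t + 1\<close> vertices by a bundle of
  \<open>t + 2\<close> parallel edges, to one more vertex by a bundle of the remaining
  \<open>r - (t + 1) (t + 2)\<close> edges, and bring the outer vertices to degree \<open>r\<close> by loops. At an
  outer vertex \<open>y\<close> the loops contribute evenly to every color, so the color of degree \<open>t\<close> at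
  \<open>y\<close> occurs an odd number of times, at most \<open>t\<close>, in its bundle: a bundle of more than \<open>t\<close>
  edges is not monochromatic. Its edges have only the two colors seen at \<open>x\<close>, so both occur in it,
  and the color of degree \<open>t\<close> at \<open>x\<close> occurs in each of the \<open>t + 1\<close> large bundles.
\<close>

lemma color_degree_ge_card:
  assumes "finite (edges G)"
    and "\<And>e. e \<in> S \<Longrightarrow> e \<in> edges G \<and> c e = a \<and> v \<in># ends G e"
  shows "card S \<le> color_degree G c a v"
proof -
  have "card S = (\<Sum>e\<in>S. 1)" by simp
  also have "\<dots> \<le> (\<Sum>e\<in>S. count (ends G e) v)"
    using assms(2) by (intro sum_mono) (simp add: Suc_le_eq)
  also have "\<dots> \<le> color_degree G c a v"
    unfolding color_degree_def using assms by (intro sum_mono2) auto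
  finally show ?thesis .
qed

text \<open>Modulo 2 the edges outside \<open>B\<close> vanish and each edge of \<open>B\<close>
  counts once. It is applied with \<open>B\<close> the bundle between the center and an outer
  vertex.\<close>

lemma even_color_degree_iff:
  assumes "finite (edges G)" "B \<subseteq> edges G"
    and "\<And>e. e \<in> B \<Longrightarrow> count (ends G e) v = 1"
    and "\<And>e. e \<in> edges G - B \<Longrightarrow> even (count (ends G e) v)"
  shows "even (color_degree G c a v) \<longleftrightarrow> even (card {e \<in> B. c e = a})"
proof -
  let ?A = "{e \<in> edges G. c e = a}" and ?B = "{e \<in> B. c e = a}"
  have "color_degree G c a v
      = (\<Sum>e\<in>?A - ?B. count (ends G e) v) + (\<Sum>e\<in>?B. count (ends G e) v)"
    unfolding color_degree_def using assms(1,2) by (intro sum.subset_diff) auto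
  also have "(\<Sum>e\<in>?B. count (ends G e) v) = card ?B"
    using assms(3) by simp
  finally show ?thesis
    using assms(4) by (auto intro: dvd_sum)
qed

text \<open>The two color degrees already exhaust the degree of \<open>v\<close>, so an edge of a
  third color at \<open>v\<close> would make the degree too large.\<close>

lemma color_cases_at_vertex:
  assumes "finite (edges G)" "a \<noteq> b"
    and "degree G v = color_degree G c a v + color_degree G c b v"
    and "e \<in> edges G" "v \<in># ends G e"
  shows "c e = a \<or> c e = b"
proof (rule ccontr)
  assume other: "\<not> (c e = a \<or> c e = b)"
  let ?E = "\<lambda>a. {e \<in> edges G. c e = a}" and ?n = "\<lambda>e. count (ends G e) v"
  have "color_degree G c a v + color_degree G c b v = (\<Sum>e\<in>?E a \<union> ?E b. ?n e)"
    unfolding color_degree_def using assms(1,2) by (subst sum.union_disjoint) auto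
  also have "\<dots> < (\<Sum>e\<in>edges G. ?n e)"
    using assms(1,4,5) other by (intro sum_strict_mono2[of _ _ e]) auto
  finally show False
    using assms(3) by (simp add: degree_def)
qed

text \<open>Separates the coloring argument from the construction: only the bundles of
  \<open>Y\<close> and the parity of the other edges at \<open>Y\<close> are constrained.\<close>

lemma not_split_colorable_if_large_bundles:
  fixes G :: "('v, 'e) pseudograph"
  assumes fin: "finite_pseudograph G" and reg: "regular r G"
    and t: "odd t" "t \<le> r"
    and x: "x \<in> verts G" and Y: "Y \<subseteq> verts G - {x}" "t < card Y"
    and large: "\<And>y. y \<in> Y \<Longrightarrow> t < card {e \<in> edges G. ends G e = {#x, y#}}"
    and rest: "\<And>y e. \<lbrakk>y \<in> Y; e \<in> edges G; ends G e \<noteq> {#x, y#}\<rbrakk> \<Longrightarrow> even (count (ends G e) y)"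
  shows "\<not> split_colorable G (r - t) t"
proof
  assume "split_colorable G (r - t) t"
  then obtain c :: "'e \<Rightarrow> nat" where c: "\<And>v. v \<in> verts G \<Longrightarrow>
      \<exists>a b. a \<noteq> b \<and> color_degree G c a v = r - t \<and> color_degree G c b v = t"
    unfolding split_colorable_def split_coloring_def by blast
  have fE: "finite (edges G)"
    using fin by (simp add: finite_pseudograph_def)
  define B where "B y = {e \<in> edges G. ends G e = {#x, y#}}" for y
  obtain a b where ab: "a \<noteq> b" "color_degree G c a x = r - t" "color_degree G c b x = t"
    using c[OF x] by blast
  have two: "c e = a \<or> c e = b" if "e \<in> B y" for e y
    using that reg x t ab fE by (intro color_cases_at_vertex[of G a b x]) (auto simp: B_def regular_def)
  have "\<exists>e\<in>B y. c e = b" if y: "y \<in> Y" for y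
  proof -
    obtain d where d: "color_degree G c d y = t"
      using c Y(1) y by blast
    have "y \<noteq> x" using y Y(1) by blast
    then have "even (color_degree G c d y) \<longleftrightarrow> even (card {e \<in> B y. c e = d})"
      using fE rest[OF y] by (intro even_color_degree_iff) (auto simp: B_def)
    then have "odd (card {e \<in> B y. c e = d})"
      using d t(1) by simp
    then obtain e where e: "e \<in> B y" "c e = d"
      by (metis (mono_tags, lifting) card.empty even_zero empty_Collect_eq)
    have "card {e \<in> B y. c e = d} \<le> t"
      using color_degree_ge_card[of G "{e \<in> B y. c e = d}" c d y] fE d by (auto simp: B_def)
    then have "{e \<in> B y. c e = d} \<noteq> B y"
      using large[OF y] by (auto simp: B_def)
    then obtain e' where "e' \<in> B y" "c e' \<noteq> d" by blast
    \<comment> \<open>The colors of \<open>e\<close> and \<open>e'\<close> differ and both lie in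
      {\<open>a\<close>, \<open>b\<close>}, so one of them is \<open>b\<close>.\<close>
    with e two[of e y] two[of e' y] show ?thesis by blast
  qed
  then obtain f where f: "\<And>y. y \<in> Y \<Longrightarrow> f y \<in> B y \<and> c (f y) = b" by metis
  \<comment> \<open>The ends of an edge determine its bundle, so the chosen edges are distinct and
    \<open>x\<close> meets at least \<open>card Y\<close> edges of color \<open>b\<close>.\<close>
  have "inj_on f Y"
  proof (rule inj_onI)
    fix y z assume "y \<in> Y" "z \<in> Y" "f y = f z"
    then have "{#x, y#} = {#x, z#}"
      using f[of y] f[of z] by (simp add: B_def)
    then show "y = z" by simp
  qed
  then have "card Y = card (f ` Y)" by (simp add: card_image)
  also have "\<dots> \<le> t"
    unfolding ab(3)[symmetric] using fE f by (intro color_degree_ge_card) (auto simp: B_def)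
  finally show False using Y(2) by simp
qed

definition loop_graph :: "nat \<Rightarrow> (nat, nat) pseudograph" where
  "loop_graph k = \<lparr>verts = {0}, edges = {..<k}, ends = (\<lambda>_. {#0, 0#})\<rparr>"

lemma finite_loop_graph: "finite_pseudograph (loop_graph k)"
  by (simp add: loop_graph_def finite_pseudograph_def)

lemma regular_loop_graph: "regular (2 * k) (loop_graph k)"
  by (simp add: loop_graph_def regular_def degree_def)

lemma loop_graph_not_split_colorable:
  assumes "odd q"
  shows "\<not> split_colorable (loop_graph k) p q"
proof
  assume "split_colorable (loop_graph k) p q"
  then obtain c :: "nat \<Rightarrow> nat" and b where "color_degree (loop_graph k) c b 0 = q"
    by (force simp: split_colorable_def split_coloring_def loop_graph_def)
  then show False
    using assms by (auto simp: color_degree_def loop_graph_def)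
qed

text \<open>
  The edge coded by \<open>(i, j)\<close> belongs to the outer vertex \<open>i\<close>: it is one of the \<open>m i\<close> edges to
  the center \<open>0\<close> if \<open>j < m i\<close>, and a loop otherwise.
\<close>

definition looped_star :: "nat \<Rightarrow> nat \<Rightarrow> (nat \<Rightarrow> nat) \<Rightarrow> (nat, nat) pseudograph" where
  "looped_star r n m =
     \<lparr>verts = {..n},
      edges = prod_encode ` (SIGMA i:{1..n}. {..<m i + (r - m i) div 2}),
      ends = (\<lambda>e. case prod_decode e of (i, j) \<Rightarrow> if j < m i then {#0, i#} else {#i, i#})\<rparr>"

lemma finite_looped_star: "finite_pseudograph (looped_star r n m)"
  by (auto simp: looped_star_def finite_pseudograph_def)

lemma degree_looped_star:
  "degree (looped_star r n m) v =
     (\<Sum>i=1..n. \<Sum>j<m i + (r - m i) div 2. count (if j < m i then {#0, i#} else {#i, i#}) v)"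
  by (simp add: degree_def looped_star_def sum.reindex[OF inj_prod_encode]
      sum.Sigma split_def cong: if_cong)

text \<open>Even \<open>r - m i\<close> makes the halving exact, so the loops fill vertex
  \<open>i\<close> up to degree \<open>r\<close>; the sum of the \<open>m i\<close> is the degree of
  the center.\<close>

lemma regular_looped_star:
  assumes m: "\<And>i. i \<in> {1..n} \<Longrightarrow> m i \<le> r \<and> even (r - m i)"
    and sum: "(\<Sum>i=1..n. m i) = r"
  shows "regular r (looped_star r n m)"
  unfolding regular_def
proof
  fix v assume v: "v \<in> verts (looped_star r n m)"
  define k where "k i = m i + (r - m i) div 2" for i
  have *: "(\<Sum>j<k i. count (if j < m i then {#0, i#} else {#i, i#}) v)
      = (if v = 0 then m i else if v = i then r else 0)" if i: "i \<in> {1..n}" for i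
  proof -
    have "(\<Sum>j<k i. count (if j < m i then {#0, i#} else {#i, i#}) v)
        = (\<Sum>j<m i. count {#0, i#} v) + (\<Sum>j=m i..<k i. count {#i, i#} v)"
    proof -
      have "{..<k i} = {..<m i} \<union> {m i..<k i}" by (auto simp: k_def)
      then show ?thesis by (simp add: sum.union_disjoint ivl_disj_int)
    qed
    moreover have "m i + 2 * ((r - m i) div 2) = r"
      using m[OF i] by (metis dvd_mult_div_cancel le_add_diff_inverse)
    ultimately show ?thesis
      using i by (simp add: k_def)
  qed
  have "degree (looped_star r n m) v
      = (\<Sum>i=1..n. if v = 0 then m i else if v = i then r else 0)"
    unfolding degree_looped_star k_def[symmetric] using * by (intro sum.cong) auto
  also have "\<dots> = r"
    using v sum by (cases "v = 0") (simp_all add: looped_star_def)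
  finally show "degree (looped_star r n m) v = r" .
qed

lemma card_bundle_looped_star:
  assumes "i \<in> {1..n}"
  shows "m i \<le> card {e \<in> edges (looped_star r n m). ends (looped_star r n m) e = {#0, i#}}"
    (is "_ \<le> card ?B")
proof -
  have "prod_encode ` ({i} \<times> {..<m i}) \<subseteq> ?B"
    using assms by (auto simp: looped_star_def)
  moreover have "finite ?B"
    using finite_looped_star by (simp add: finite_pseudograph_def)
  ultimately have "card (prod_encode ` ({i} \<times> {..<m i})) \<le> card ?B"
    by (rule card_mono[rotated])
  then show ?thesis
    by (simp add: card_image[OF inj_prod_encode] card_cartesian_product)
qed

lemma looped_star_not_split_colorable:
  assumes m: "\<And>i. i \<in> {1..n} \<Longrightarrow> m i \<le> r \<and> even (r - m i)"
    and sum: "(\<Sum>i=1..n. m i) = r"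
    and t: "odd t" "t \<le> r"
    and Y: "Y \<subseteq> {1..n}" "t < card Y" "\<And>i. i \<in> Y \<Longrightarrow> t < m i"
  shows "\<not> split_colorable (looped_star r n m) (r - t) t"
proof (rule not_split_colorable_if_large_bundles[OF finite_looped_star regular_looped_star t])
  show "t < card {e \<in> edges (looped_star r n m). ends (looped_star r n m) e = {#0, i#}}"
    if "i \<in> Y" for i
    using Y(1) Y(3)[OF that] card_bundle_looped_star[of i n m r] that by fastforce
  \<comment> \<open>Such an edge is a loop at \<open>i\<close>, counted twice, or belongs to another
    outer vertex and misses \<open>i\<close>.\<close>
  show "even (count (ends (looped_star r n m) e) i)"
    if "i \<in> Y" "e \<in> edges (looped_star r n m)" "ends (looped_star r n m) e \<noteq> {#0, i#}" for i e
    using that Y(1) by (auto simp: looped_star_def split: if_splits)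
qed (use m sum Y in \<open>auto simp: looped_star_def\<close>)

theorem theorem9:
  fixes r t :: nat
  assumes "r > 0" and "t > 0"
    and "real t \<le> real r / 2"
    and "odd t"
    and "even r \<or> r \<ge> (t + 2) * (t + 1)"
  shows "\<exists>G :: (nat, nat) pseudograph.
           finite_pseudograph G \<and> regular r G \<and> \<not> split_colorable G (r - t) t"
proof (cases "even r")
  case True
  then obtain k where "r = 2 * k" by blast
  then show ?thesis
    using finite_loop_graph regular_loop_graph loop_graph_not_split_colorable[OF assms(4)] by blast
next
  case False
  then have r: "(t + 1) * (t + 2) \<le> r"
    using assms(5) by (simp add: mult.commute)
  define m where "m i = (if i = t + 2 then r - (t + 1) * (t + 2) else t + 2)" for i
  have m: "m i \<le> r \<and> even (r - m i)" for i
  proof -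
    have "t + 2 \<le> r" using r by simp
    \<comment> \<open>For \<open>i = t + 2\<close> the difference is
      \<open>(t + 1) * (t + 2)\<close>, a product of consecutive numbers; otherwise it is odd minus
      odd.\<close>
    then show ?thesis
      using False assms(4) r by (simp add: m_def)
  qed
  have "{1..t + 2} = insert (t + 2) {1..t + 1}" by auto
  then have sum: "(\<Sum>i=1..t + 2. m i) = r"
    using r by (simp add: m_def)
  have "\<not> split_colorable (looped_star r (t + 2) m) (r - t) t"
    using m sum assms(4) r
    by (intro looped_star_not_split_colorable[where Y = "{1..t + 1}"]) (auto simp: m_def)
  then show ?thesis
    using finite_looped_star regular_looped_star[OF m sum] by blast
qed

end
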